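(* Let $G=(V,E)$ be a connected outer-planar graph and let $u\in V$ be an arbitrary vertex. Then $G$ is a general-ladder with anchor $u$, in which the vertices of the layers are classified by their distances to $u$ (i.e. the layers, from the top, are the sets of vertices at distance $0,1,2,\ldots$ from $u$ in $G$).
   Context: All graphs are simple and undirected; $N[v]$ is the closed neighbourhood of $v$. An outer-planar graph is a graph admitting a planar embedding such that all the vertices lie on a fixed circle and all edges are straight lines drawn inside the circle. A path $P=(v_1,\ldots,v_k)$ is an ordered path if a total order $v_1\prec v_2\prec\cdots\prec v_k$ or $v_k\prec v_{k-1}\prec\cdots\prec v_1$ is defined on its vertices. A graph $G=(V,E)$ is a general-ladder if a total order $\prec$ on the set of vertices is defined, and $G$ is composed of a set of layers $\{\mathcal L_1,\ldots,\mathcal L_k\}$ (partitioning the vertices), where each layer is a collection of subpaths of an ordered path, such that the following holds. The top layer $\mathcal L_1$ consists of a single vertex, called the anchor, and for each $1<j<k$ and $u,v\in\mathcal L_j$ we have (1) $N[u]\subseteq \mathcal L_{j-1}\cup\mathcal L_j\cup\mathcal L_{j+1}$, and (2) $u\prec v$ implies $\max_{p\in N[u]\cap\mathcal L_{j+1}}p\preccurlyeq\min_{q\in N[v]\cap\mathcal L_{j+1}}q$ (a condition that is vacuous if one of these sets is empty). *)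

theory Defs
  imports
    "HOL-Analysis.Analysis"
    "HOL-Library.Disjoint_Sets"
    "HOL-Library.Sublist"
    "Graph_Theory.Graph_Theory"
begin

text \<open>
  A finite simple undirected graph is a \<^locale>\<open>pair_graph\<close>: a finite digraph without loops whose
  arc relation is symmetric, so an edge joining \<open>a\<close> and \<open>b\<close> is present as both \<open>(a, b)\<close> and
  \<open>(b, a)\<close>.  The plane is \<^typ>\<open>complex\<close>.  Note that \<open>connected\<close> exists both for graphs and
  for topological spaces; the former is \<open>Digraph_Component.connected\<close>.
\<close>

definition closed_nbhd :: "'a pair_pre_digraph \<Rightarrow> 'a \<Rightarrow> 'a set" where
  "closed_nbhd G v = insert v {w. (v, w) \<in> parcs G}"

definition outer_planar :: "'a pair_pre_digraph \<Rightarrow> bool" where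
  "outer_planar G \<longleftrightarrow>
    (\<exists>(\<phi> :: 'a \<Rightarrow> complex) z \<rho>. 0 < \<rho> \<and>
      inj_on \<phi> (pverts G) \<and> \<phi> ` pverts G \<subseteq> sphere z \<rho> \<and>
      (\<forall>a b. (a, b) \<in> parcs G \<longrightarrow>
        open_segment (\<phi> a) (\<phi> b) \<subseteq> ball z \<rho> \<and>
        open_segment (\<phi> a) (\<phi> b) \<inter> \<phi> ` pverts G = {}) \<and>
      (\<forall>a b c d. (a, b) \<in> parcs G \<longrightarrow> (c, d) \<in> parcs G \<longrightarrow> {a, b} \<noteq> {c, d} \<longrightarrow>
        open_segment (\<phi> a) (\<phi> b) \<inter> open_segment (\<phi> c) (\<phi> d) = {}))"

text \<open>
  Below, \<open>r\<close> is the reflexive version of the total order on the vertices: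
  \<open>(x, y) \<in> r\<close> means \<open>x \<preceq> y\<close>.
\<close>

definition rel_less :: "'a rel \<Rightarrow> 'a \<Rightarrow> 'a \<Rightarrow> bool" where
  "rel_less r x y \<longleftrightarrow> (x, y) \<in> r \<and> x \<noteq> y"

definition rel_max :: "'a rel \<Rightarrow> 'a set \<Rightarrow> 'a" where
  "rel_max r S = (THE m. m \<in> S \<and> (\<forall>x\<in>S. (x, m) \<in> r))"

definition rel_min :: "'a rel \<Rightarrow> 'a set \<Rightarrow> 'a" where
  "rel_min r S = (THE m. m \<in> S \<and> (\<forall>x\<in>S. (m, x) \<in> r))"

text \<open>
  A path is given by its vertex sequence.  The ordered path need not itself be a subgraph of \<open>G\<close>;
  only the subpaths forming a layer are.
\<close>

definition ordered_path :: "'a rel \<Rightarrow> 'a list \<Rightarrow> bool" where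
  "ordered_path r P \<longleftrightarrow> P \<noteq> [] \<and> distinct P \<and>
    (sorted_wrt (rel_less r) P \<or> sorted_wrt (rel_less r) (rev P))"

text \<open>
  The subgraph of \<open>G\<close> induced by \<open>L\<close> is the disjoint union of a collection \<open>\<Q>\<close> of subpaths of an
  ordered path; a subpath may be a single vertex.
\<close>

definition ordered_subpaths :: "'a pair_pre_digraph \<Rightarrow> 'a rel \<Rightarrow> 'a set \<Rightarrow> bool" where
  "ordered_subpaths G r L \<longleftrightarrow>
    (\<exists>P \<Q>. ordered_path r P \<and> set P \<subseteq> pverts G \<and>
      (\<forall>Q\<in>\<Q>. Q \<noteq> [] \<and> sublist Q P) \<and>
      disjoint_family_on set \<Q> \<and>
      (\<Union>Q\<in>\<Q>. set Q) = L \<and>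
      (\<Union>Q\<in>\<Q>. set (vwalk_arcs Q) \<union> (set (vwalk_arcs Q))\<inverse>) = parcs G \<inter> L \<times> L)"

definition general_ladder ::
    "'a pair_pre_digraph \<Rightarrow> 'a rel \<Rightarrow> nat \<Rightarrow> (nat \<Rightarrow> 'a set) \<Rightarrow> 'a \<Rightarrow> bool" where
  "general_ladder G r k L anchor \<longleftrightarrow>
    linear_order_on (pverts G) r \<and>
    1 \<le> k \<and> inj_on L {1..k} \<and> partition_on (pverts G) (L ` {1..k}) \<and>
    (\<forall>j\<in>{1..k}. ordered_subpaths G r (L j)) \<and>
    L 1 = {anchor} \<and>
    (\<forall>j. 1 < j \<longrightarrow> j < k \<longrightarrow> (\<forall>x\<in>L j. \<forall>y\<in>L j.
      closed_nbhd G x \<subseteq> L (j - 1) \<union> L j \<union> L (j + 1) \<and>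
      (rel_less r x y \<longrightarrow>
        closed_nbhd G x \<inter> L (j + 1) \<noteq> {} \<longrightarrow> closed_nbhd G y \<inter> L (j + 1) \<noteq> {} \<longrightarrow>
        (rel_max r (closed_nbhd G x \<inter> L (j + 1)),
         rel_min r (closed_nbhd G y \<inter> L (j + 1))) \<in> r)))"

text \<open>
  \<open>wf_digraph.\<mu>\<close> is the infimum of the costs of all walks between two vertices, so with unit arc
  costs it is the graph distance.
\<close>

definition dist_layer :: "'a pair_pre_digraph \<Rightarrow> 'a \<Rightarrow> nat \<Rightarrow> 'a set" where
  "dist_layer G u d =
    {v \<in> pverts G. wf_digraph.\<mu> (with_proj G) (\<lambda>_. 1) u v = ereal (real d)}"

end

theory Submission
  imports Defs
begin

text \<open>
  Order the vertices by their angle around the circle, starting at the anchor \<open>u\<close>.  The heart of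
  the matter is that an edge \<open>ab\<close> with \<open>a \<prec> c \<prec> b\<close> separates \<open>c\<close> from \<open>u\<close>: a shortest path from \<open>u\<close>
  to \<open>c\<close> cannot cross the chord \<open>ab\<close>, so it passes through \<open>a\<close> or \<open>b\<close>, and one of these is strictly
  closer to \<open>u\<close> than \<open>c\<close>.  Hence an edge inside a layer joins consecutive vertices of that layer; and
  if \<open>x \<prec> y\<close> lie in one layer and have neighbours \<open>q \<prec> p\<close> of \<open>y\<close> and \<open>x\<close> in the next one, then
  \<open>xp\<close> and \<open>yq\<close> either cross or one of them separates \<open>x\<close> or \<open>y\<close>, which is no farther from \<open>u\<close> than
  both its ends, from \<open>u\<close>.
\<close>

section \<open>Crossing chords of a circle\<close>

text \<open>The expression factors as four times the product of the sines of \<open>x\<close>,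
  \<open>y\<close> and \<open>x + y\<close>, the halves of the angular gaps, which all lie strictly
  between 0 and \<open>pi\<close>.\<close>

lemma sin_triangle_pos:
  fixes p q r :: real
  assumes "p < q" "q < r" "r < p + 2 * pi"
  shows "0 < sin (q - p) + sin (r - q) - sin (r - p)"
proof -
  define x y where "x = (q - p) / 2" and "y = (r - q) / 2"
  have *: "q - p = 2 * x" "r - q = 2 * y" "r - p = 2 * (x + y)"
    by (auto simp: x_def y_def field_simps)
  have "sin (2 * x) + sin (2 * y) - sin (2 * (x + y)) = 4 * sin x * sin y * sin (x + y)"
  proof -
    have "sin (2 * (x + y)) = 2 * sin (x + y) * cos (x + y)"
      by (rule sin_double)
    moreover have "(sin x)\<^sup>2 + (cos x)\<^sup>2 = 1" "(sin y)\<^sup>2 + (cos y)\<^sup>2 = 1"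
      by simp_all
    ultimately show ?thesis
      unfolding sin_double sin_add cos_add by algebra
  qed
  moreover have "0 < sin x" "0 < sin y" "0 < sin (x + y)"
    using assms by (auto intro!: sin_gt_zero simp: x_def y_def field_simps)
  ultimately show ?thesis
    unfolding * by simp
qed

lemma in_open_segment_weighted:
  fixes a b :: complex
  assumes "a \<noteq> b" "0 < A" "0 < B"
  shows "(A / (A + B)) *\<^sub>R a + (B / (A + B)) *\<^sub>R b \<in> open_segment a b"
proof -
  have "A / (A + B) = 1 - B / (A + B)"
    using assms by (simp add: field_simps)
  then show ?thesis
    using assms unfolding in_segment by (intro conjI exI[of _ "B / (A + B)"]) auto
qed

lemma cis_neq:
  assumes "s < t" "t < s + 2 * pi"
  shows "cis s \<noteq> cis t"
proof
  assume "cis s = cis t"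
  then have "cis (t - s) = 1"
    by (simp flip: cis_divide)
  then have "cos (t - s) = 1"
    by (metis cis.simps(1) one_complex.simps(1))
  moreover have "0 < sin ((t - s) / 2)"
    using assms by (intro sin_gt_zero) auto
  moreover have "cos (t - s) = 1 - 2 * (sin ((t - s) / 2))\<^sup>2"
    using cos_double_sin[of "(t - s) / 2"] by (simp only: mult_2 field_sum_of_halves)
  ultimately show False
    by simp
qed

text \<open>The crossing point is explicit: four points of the plane satisfy a linear relation whose
  weights are triangle areas. As the endpoints alternate, all weights are positive, and both sides
  of the relation, once normalised, are points inside the two chords.\<close>

lemma circle_chords_cross:
  fixes z c :: complex
  assumes "c \<noteq> 0" and t: "t1 < t2" "t2 < t3" "t3 < t4" "t4 < t1 + 2 * pi"
  shows "open_segment (z + c * cis t1) (z + c * cis t3) \<inter>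
    open_segment (z + c * cis t2) (z + c * cis t4) \<noteq> {}"
proof -
  \<comment> \<open>\<open>h\<close> is twice the signed area of the triangle with vertices \<open>cis p\<close>, \<open>cis q\<close>, \<open>cis r\<close>.\<close>
  define h :: "real \<Rightarrow> real \<Rightarrow> real \<Rightarrow> real"
    where "h p q r = sin (q - p) + sin (r - q) - sin (r - p)" for p q r
  have pos: "0 < h t2 t3 t4" "0 < h t1 t3 t4" "0 < h t1 t2 t4" "0 < h t1 t2 t3"
    unfolding h_def using t by (intro sin_triangle_pos; linarith)+
  define S where "S = h t2 t3 t4 + h t1 t2 t4"
  \<comment> \<open>Both sums are twice the area of the inscribed quadrilateral, cut along one
    diagonal or the other, so one normalising factor serves both chords.\<close>
  have S: "S = h t1 t3 t4 + h t1 t2 t3"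
    by (simp add: S_def h_def)
  have "S > 0"
    using pos by (simp add: S_def)
  have "h t2 t3 t4 * cos t1 + h t1 t2 t4 * cos t3 = h t1 t3 t4 * cos t2 + h t1 t2 t3 * cos t4"
    "h t2 t3 t4 * sin t1 + h t1 t2 t4 * sin t3 = h t1 t3 t4 * sin t2 + h t1 t2 t3 * sin t4"
    unfolding h_def sin_diff by algebra+
  then have cramer: "h t2 t3 t4 *\<^sub>R cis t1 + h t1 t2 t4 *\<^sub>R cis t3
      = h t1 t3 t4 *\<^sub>R cis t2 + h t1 t2 t3 *\<^sub>R cis t4"
    by (simp add: complex_eq_iff)
  have comb: "(A / (A + B)) *\<^sub>R (z + c * v) + (B / (A + B)) *\<^sub>R (z + c * w)
      = z + c * ((A *\<^sub>R v + B *\<^sub>R w) /\<^sub>R (A + B))" if "A + B > 0" for A B v w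
  proof -
    have "(A / (A + B)) *\<^sub>R z + (B / (A + B)) *\<^sub>R z = z"
      using that by (simp flip: scaleR_add_left add_divide_distrib)
    then show ?thesis
      by (simp add: algebra_simps divide_inverse)
  qed
  have "cis t1 \<noteq> cis t3" "cis t2 \<noteq> cis t4"
    using t cis_neq[of t1 t3] cis_neq[of t2 t4] by auto
  then have "z + c * cis t1 \<noteq> z + c * cis t3" "z + c * cis t2 \<noteq> z + c * cis t4"
    using \<open>c \<noteq> 0\<close> by auto
  from this[THEN in_open_segment_weighted] have
    "z + c * ((h t2 t3 t4 *\<^sub>R cis t1 + h t1 t2 t4 *\<^sub>R cis t3) /\<^sub>R S)
      \<in> open_segment (z + c * cis t1) (z + c * cis t3)"
    "z + c * ((h t1 t3 t4 *\<^sub>R cis t2 + h t1 t2 t3 *\<^sub>R cis t4) /\<^sub>R S)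
      \<in> open_segment (z + c * cis t2) (z + c * cis t4)"
    using pos \<open>S > 0\<close> comb unfolding S_def by (metis, metis S S_def)
  then show ?thesis
    unfolding cramer by blast
qed

lemma circle_angle:
  fixes z c w :: complex
  assumes "c \<noteq> 0" "dist z w = norm c"
  shows "w = z + c * cis (Arg2pi ((w - z) / c))"
proof -
  have "norm ((w - z) / c) = 1"
    using assms by (simp add: norm_divide dist_norm norm_minus_commute)
  then have "cis (Arg2pi ((w - z) / c)) = (w - z) / c"
    unfolding cis_conv_exp using complex_norm_eq_1_exp by blast
  then show ?thesis
    using assms by simp
qed

section \<open>Splitting a list into runs\<close>

text \<open>The list is cut exactly between neighbours whose pair lies outside \<open>R\<close>.
  With \<open>R\<close> the arcs of the graph, the pieces are the subpaths that form a
  layer.\<close>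

lemma split_into_runs:
  obtains Qs where "concat Qs = P" "[] \<notin> set Qs"
    "(\<Union>Q\<in>set Qs. set (vwalk_arcs Q)) = set (vwalk_arcs P) \<inter> R"
proof -
  have "\<exists>Qs. concat Qs = P \<and> [] \<notin> set Qs \<and>
    (\<Union>Q\<in>set Qs. set (vwalk_arcs Q)) = set (vwalk_arcs P) \<inter> R"
  proof (induction P)
    case Nil
    show ?case
      by (rule exI[of _ "[]"]) simp
  next
    case (Cons x xs)
    then obtain Qs where Qs: "concat Qs = xs" "[] \<notin> set Qs"
      "(\<Union>Q\<in>set Qs. set (vwalk_arcs Q)) = set (vwalk_arcs xs) \<inter> R"
      by blast
    show ?case
    proof (cases "xs \<noteq> [] \<and> (x, hd xs) \<in> R")
      case True
      then obtain Q Qs' where "Qs = Q # Qs'"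
        using Qs(1) by (cases Qs) auto
      moreover from this have "Q \<noteq> []" "hd xs = hd Q"
        using Qs(1,2) by auto
      ultimately show ?thesis
        using Qs True by (intro exI[of _ "(x # Q) # Qs'"]) auto
    next
      case False
      then show ?thesis
        using Qs by (intro exI[of _ "[x] # Qs"]) (cases xs; auto)
    qed
  qed
  then show ?thesis
    using that by blast
qed

lemma vwalk_arcs_nth:
  assumes "Suc i < length P"
  shows "(P ! i, P ! Suc i) \<in> set (vwalk_arcs P)"
  using assms
proof (induction P arbitrary: i rule: vwalk_arcs.induct)
  case (3 x y xs)
  then show ?case
    by (cases i) auto
qed auto

lemma vwalk_arcs_subset: "set (vwalk_arcs P) \<subseteq> set P \<times> set P"
  by (induction P rule: vwalk_arcs.induct) auto

lemma sublist_concat: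
  assumes "Q \<in> set Qs"
  shows "sublist Q (concat Qs)"
proof -
  obtain ys zs where "Qs = ys @ Q # zs"
    using split_list[OF assms] by blast
  then have "concat Qs = concat ys @ Q @ concat zs"
    by simp
  then show ?thesis
    unfolding sublist_def by blast
qed

lemma disjoint_family_on_set_concat:
  assumes "distinct (concat Qs)"
  shows "disjoint_family_on set (set Qs)"
  using assms by (auto simp: disjoint_family_on_def distinct_concat_iff)

section \<open>Layers of a noncrossing circular arrangement\<close>

definition order_by :: "'a set \<Rightarrow> ('a \<Rightarrow> 'b::linorder) \<Rightarrow> 'a rel" where
  "order_by V \<theta> = {(x, y). x \<in> V \<and> y \<in> V \<and> \<theta> x \<le> \<theta> y}"

lemma linear_order_order_by:
  assumes "inj_on \<theta> V"
  shows "linear_order_on V (order_by V \<theta>)"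
  using assms unfolding order_by_def order_on_defs
  by (auto simp: refl_on_def trans_def antisym_def total_on_def inj_on_def)

lemma rel_less_order_by:
  assumes "inj_on \<theta> V"
  shows "rel_less (order_by V \<theta>) x y \<longleftrightarrow> x \<in> V \<and> y \<in> V \<and> \<theta> x < \<theta> y"
  using assms by (auto simp: rel_less_def order_by_def inj_on_def less_le)

text \<open>Shows that the definite description in \<open>rel_max\<close> is satisfied. Membership
  suffices later, because monotonicity is proved for arbitrary neighbours in the next layer.\<close>

lemma rel_max_order_by_in:
  assumes "inj_on \<theta> V" "finite S" "S \<noteq> {}" "S \<subseteq> V"
  shows "rel_max (order_by V \<theta>) S \<in> S"
proof -
  have "Max (\<theta> ` S) \<in> \<theta> ` S"
    using assms by (intro Max_in) auto
  then obtain m where m: "m \<in> S" "\<theta> m = Max (\<theta> ` S)"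
    by auto
  have "rel_max (order_by V \<theta>) S = m"
    unfolding rel_max_def
  proof (rule the_equality)
    show "m \<in> S \<and> (\<forall>x\<in>S. (x, m) \<in> order_by V \<theta>)"
      using assms m by (auto simp: order_by_def)
  next
    fix m' assume m': "m' \<in> S \<and> (\<forall>x\<in>S. (x, m') \<in> order_by V \<theta>)"
    then have "\<theta> m' = \<theta> m"
      using assms m by (intro antisym) (auto simp: order_by_def)
    then show "m' = m"
      using assms(1,4) m(1) m' by (meson inj_onD subsetD)
  qed
  then show ?thesis
    using m by simp
qed

lemma rel_min_order_by_in:
  assumes "inj_on \<theta> V" "finite S" "S \<noteq> {}" "S \<subseteq> V"
  shows "rel_min (order_by V \<theta>) S \<in> S"
proof -
  have "Min (\<theta> ` S) \<in> \<theta> ` S"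
    using assms by (intro Min_in) auto
  then obtain m where m: "m \<in> S" "\<theta> m = Min (\<theta> ` S)"
    by auto
  have "rel_min (order_by V \<theta>) S = m"
    unfolding rel_min_def
  proof (rule the_equality)
    show "m \<in> S \<and> (\<forall>x\<in>S. (m, x) \<in> order_by V \<theta>)"
      using assms m by (auto simp: order_by_def)
  next
    fix m' assume m': "m' \<in> S \<and> (\<forall>x\<in>S. (m', x) \<in> order_by V \<theta>)"
    then have "\<theta> m' = \<theta> m"
      using assms m by (intro antisym) (auto simp: order_by_def)
    then show "m' = m"
      using assms(1,4) m(1) m' by (meson inj_onD subsetD)
  qed
  then show ?thesis
    using m by simp
qed

lemma sorted_list_by:
  fixes \<theta> :: "'a \<Rightarrow> 'b::linorder"
  assumes "finite L" "inj_on \<theta> L"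
  obtains P where "set P = L" "sorted_wrt (\<lambda>x y. \<theta> x < \<theta> y) P"
proof
  let ?P = "map (the_inv_into L \<theta>) (sorted_list_of_set (\<theta> ` L))"
  show "set ?P = L"
    using assms by (simp add: image_image the_inv_into_f_f)
  have "sorted_wrt (<) (sorted_list_of_set (\<theta> ` L))"
    by (rule strict_sorted_list_of_set)
  then show "sorted_wrt (\<lambda>x y. \<theta> x < \<theta> y) ?P"
    unfolding sorted_wrt_map
    by (rule sorted_wrt_mono_rel[rotated]) (use assms in \<open>auto simp: the_inv_into_f_f\<close>)
qed

lemma sorted_consecutive_arc:
  assumes P: "sorted_wrt (\<lambda>x y. (\<theta> x :: 'b::linorder) < \<theta> y) P"
    and "a \<in> set P" "b \<in> set P" "\<theta> a < \<theta> b"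
    and gap: "\<And>c. c \<in> set P \<Longrightarrow> \<theta> a < \<theta> c \<Longrightarrow> \<theta> c < \<theta> b \<Longrightarrow> False"
  shows "(a, b) \<in> set (vwalk_arcs P)"
proof -
  obtain i j where ij: "i < length P" "a = P ! i" "j < length P" "b = P ! j"
    using assms(2,3) by (auto simp: in_set_conv_nth)
  have mono: "\<theta> (P ! m) < \<theta> (P ! n)" if "m < n" "n < length P" for m n
    using P that by (simp add: sorted_wrt_iff_nth_less)
  have "i < j"
    using mono[of j i] ij \<open>\<theta> a < \<theta> b\<close> by (cases i j rule: linorder_cases) auto
  moreover have "\<not> Suc i < j"
    using gap[of "P ! Suc i"] mono[of i "Suc i"] mono[of "Suc i" j] ij by auto
  ultimately have "j = Suc i"
    by simp
  then show ?thesis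
    using vwalk_arcs_nth ij by metis
qed

text \<open>Separates the combinatorics from the geometry. \<open>noncrossing\<close> records that
  chords with interleaved ends do not occur, and the axioms on \<open>d\<close> are the properties
  of breadth-first levels from \<open>u\<close>.\<close>

locale circular_layering = pair_graph G for G :: "'a pair_pre_digraph" +
  fixes u :: 'a and \<theta> :: "'a \<Rightarrow> real" and d :: "'a \<Rightarrow> nat"
  assumes root_in_verts: "u \<in> pverts G"
    and angle_inj: "inj_on \<theta> (pverts G)"
    and angle_root_le: "\<And>v. v \<in> pverts G \<Longrightarrow> \<theta> u \<le> \<theta> v"
    and noncrossing: "\<And>a b c e. (a, b) \<in> parcs G \<Longrightarrow> (c, e) \<in> parcs G \<Longrightarrow>
      \<theta> a < \<theta> c \<Longrightarrow> \<theta> c < \<theta> b \<Longrightarrow> \<theta> b < \<theta> e \<Longrightarrow> False"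
    and depth_eq_0: "\<And>v. v \<in> pverts G \<Longrightarrow> d v = 0 \<longleftrightarrow> v = u"
    and depth_arc: "\<And>v w. (v, w) \<in> parcs G \<Longrightarrow> d w \<le> Suc (d v)"
    and depth_pred: "\<And>v n. v \<in> pverts G \<Longrightarrow> d v = Suc n \<Longrightarrow> \<exists>w. (w, v) \<in> parcs G \<and> d w = n"
begin

definition layer :: "nat \<Rightarrow> 'a set" where
  "layer n = {v \<in> pverts G. d v = n}"

lemma angle_eqD: "\<theta> x = \<theta> y \<Longrightarrow> x \<in> pverts G \<Longrightarrow> y \<in> pverts G \<Longrightarrow> x = y"
  using angle_inj by (auto simp: inj_on_def)

text \<open>Induction on the depth of \<open>c\<close> through a neighbour \<open>w\<close> one
  level above it. If \<open>w\<close> lies outside the range of the chord, its arc to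
  \<open>c\<close> crosses the chord; if \<open>w\<close> is an end, that end is closer; otherwise
  the induction hypothesis applies to \<open>w\<close>.\<close>

lemma arc_separates:
  assumes ab: "(a, b) \<in> parcs G" and "c \<in> pverts G" "\<theta> a < \<theta> c" "\<theta> c < \<theta> b"
  shows "d a < d c \<or> d b < d c"
  using assms(2-)
proof (induction "d c" arbitrary: c)
  case 0
  then have "c = u"
    using depth_eq_0 by metis
  then show ?case
    using angle_root_le[of a] 0 ab in_arcsD1 by fastforce
next
  case (Suc n)
  then obtain w where w: "(w, c) \<in> parcs G" "d w = n"
    using depth_pred by metis
  have V: "a \<in> pverts G" "b \<in> pverts G" "w \<in> pverts G"
    using ab w in_arcsD1 in_arcsD2 by blast+
  consider "\<theta> w < \<theta> a" | "w = a" | "\<theta> a < \<theta> w" "\<theta> w < \<theta> b" | "w = b" | "\<theta> b < \<theta> w"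
    using angle_eqD V by (metis linorder_neqE)
  then show ?case
  proof cases
    case 1
    then show ?thesis
      using noncrossing[OF w(1) ab] Suc.prems by blast
  next
    case 3
    then have "d a < d w \<or> d b < d w"
      using Suc.hyps(1)[of w] w V by blast
    then show ?thesis
      using w Suc.hyps(2) by linarith
  next
    case 5
    then show ?thesis
      using noncrossing[OF ab arcs_symmetric[OF w(1)]] Suc.prems by blast
  qed (use w Suc.hyps(2) in auto)
qed

lemma next_layer_mono:
  assumes "(x, p) \<in> parcs G" "(y, q) \<in> parcs G" "d x = n" "d y = n" "d p = Suc n" "d q = Suc n"
    and "\<theta> x < \<theta> y"
  shows "\<theta> p \<le> \<theta> q"
proof (rule ccontr)
  assume "\<not> \<theta> p \<le> \<theta> q"
  then have "\<theta> q < \<theta> p"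
    by simp
  have V: "x \<in> pverts G" "y \<in> pverts G" "p \<in> pverts G" "q \<in> pverts G"
    using assms(1,2) in_arcsD1 in_arcsD2 by blast+
  have ne: "\<theta> x \<noteq> \<theta> p" "\<theta> x \<noteq> \<theta> q" "\<theta> y \<noteq> \<theta> p" "\<theta> y \<noteq> \<theta> q"
    using angle_eqD V assms(3-6) by (metis n_not_Suc_n)+
  \<comment> \<open>Neither end of the arc from \<open>x\<close> to \<open>p\<close> has smaller
    depth than \<open>y\<close>, so \<open>y\<close> cannot lie between them; the same argument
    applies to \<open>x\<close> below.\<close>
  have y: "\<not> (\<theta> x < \<theta> y \<and> \<theta> y < \<theta> p)"
    using arc_separates[OF assms(1) V(2)] assms by auto
  have x: "\<not> (\<theta> q < \<theta> x \<and> \<theta> x < \<theta> y)"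
    using arc_separates[OF arcs_symmetric[OF assms(2)] V(1)] assms by auto
  \<comment> \<open>The only order left is \<open>x\<close>, \<open>q\<close>, \<open>p\<close>,
    \<open>y\<close>, in which the two chords cross.\<close>
  have "\<not> (\<theta> x < \<theta> q \<and> \<theta> q < \<theta> p \<and> \<theta> p < \<theta> y)"
    using noncrossing[OF assms(1) arcs_symmetric[OF assms(2)]] by blast
  then show False
    using x y ne \<open>\<theta> q < \<theta> p\<close> \<open>\<theta> x < \<theta> y\<close> by linarith
qed

text \<open>The ordered path is the whole layer listed by angle, and the subpaths are its runs along
  arcs. No arc inside the layer is missed, since by separation each joins consecutive entries of the
  list.\<close>

lemma ordered_subpaths_layer:
  assumes "layer n \<noteq> {}"
  shows "ordered_subpaths G (order_by (pverts G) \<theta>) (layer n)"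
proof -
  let ?L = "layer n" and ?r = "order_by (pverts G) \<theta>"
  have LV: "?L \<subseteq> pverts G"
    by (auto simp: layer_def)
  have "finite ?L" "inj_on \<theta> ?L"
    using LV finite_subset pair_finite_verts angle_inj inj_on_subset by metis+
  then obtain P where P: "set P = ?L" "sorted_wrt (\<lambda>x y. \<theta> x < \<theta> y) P"
    by (rule sorted_list_by)
  obtain Qs where Qs: "concat Qs = P" "[] \<notin> set Qs"
    "(\<Union>Q\<in>set Qs. set (vwalk_arcs Q)) = set (vwalk_arcs P) \<inter> parcs G"
    by (rule split_into_runs)
  have dist: "distinct P"
    using P(2) by (auto simp: distinct_conv_nth sorted_wrt_iff_nth_less)
      (metis less_irrefl linorder_neqE_nat)
  have "sorted_wrt (rel_less ?r) P"
    using P LV by (intro sorted_wrt_mono_rel[OF _ P(2)]) (auto simp: rel_less_order_by[OF angle_inj])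
  then have path: "ordered_path ?r P"
    using dist P(1) assms by (auto simp: ordered_path_def)
  have arcs: "(a, b) \<in> set (vwalk_arcs P)"
    if "(a, b) \<in> parcs G" "a \<in> ?L" "b \<in> ?L" "\<theta> a < \<theta> b" for a b
  proof (rule sorted_consecutive_arc[OF P(2)])
    fix c assume "c \<in> set P" "\<theta> a < \<theta> c" "\<theta> c < \<theta> b"
    then show False
      using arc_separates[OF that(1), of c] that P(1) by (auto simp: layer_def)
  qed (use that P(1) in auto)
  \<comment> \<open>The list yields arcs only in the direction of increasing angle; the converse
    supplies the other orientation of each edge.\<close>
  let ?A = "set (vwalk_arcs P) \<inter> parcs G"
  have "?A \<union> ?A\<inverse> = parcs G \<inter> ?L \<times> ?L"
  proof (intro equalityI subsetI)
    fix e assume "e \<in> ?A \<union> ?A\<inverse>"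
    then show "e \<in> parcs G \<inter> ?L \<times> ?L"
      using vwalk_arcs_subset[of P] P(1) arcs_symmetric by auto
  next
    fix e assume e: "e \<in> parcs G \<inter> ?L \<times> ?L"
    obtain a b where ab: "e = (a, b)" "(a, b) \<in> parcs G" "a \<in> ?L" "b \<in> ?L"
      using e by (cases e) auto
    then have "\<theta> a \<noteq> \<theta> b"
      using LV angle_eqD no_loops' by blast
    then show "e \<in> ?A \<union> ?A\<inverse>"
      using arcs[of a b] arcs[of b a] ab arcs_symmetric by (auto simp: neq_iff)
  qed
  moreover have "(\<Union>Q\<in>set Qs. set (vwalk_arcs Q) \<union> (set (vwalk_arcs Q))\<inverse>) = ?A \<union> ?A\<inverse>"
    unfolding Qs(3)[symmetric] by blast
  moreover have "(\<Union>Q\<in>set Qs. set Q) = ?L"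
    using P(1) unfolding Qs(1)[symmetric] by simp
  moreover have "disjoint_family_on set (set Qs)"
    using dist unfolding Qs(1)[symmetric] by (rule disjoint_family_on_set_concat)
  moreover have "\<forall>Q\<in>set Qs. Q \<noteq> [] \<and> sublist Q P"
    using Qs(2) sublist_concat unfolding Qs(1)[symmetric] by metis
  ultimately show ?thesis
    unfolding ordered_subpaths_def using path equalityD1[OF P(1)] LV
    by (intro exI[of _ P] exI[of _ "set Qs"] conjI) (assumption | metis subset_trans)+
qed

text \<open>The eccentricity of \<open>u\<close> when \<open>d\<close> is the graph
  distance.\<close>

definition depth :: nat where
  "depth = Max (d ` pverts G)"

text \<open>Downward induction from the deepest layer: a vertex at depth \<open>Suc n\<close> has a
  neighbour at depth \<open>n\<close>.\<close>

lemma layer_nonempty: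
  assumes "n \<le> depth"
  shows "layer n \<noteq> {}"
  using assms
proof (induction rule: inc_induct)
  case base
  have "depth \<in> d ` pverts G"
    unfolding depth_def using root_in_verts pair_finite_verts by (intro Max_in) auto
  then show ?case
    by (auto simp: layer_def)
next
  case (step n)
  then show ?case
    using depth_pred in_arcsD1 by (fastforce simp: layer_def)
qed

lemma in_layer_depth: "v \<in> pverts G \<Longrightarrow> d v \<le> depth"
  unfolding depth_def using pair_finite_verts by simp

text \<open>Ladder layers are numbered from 1 and depths from 0, hence the shift
  \<open>j - 1\<close> and the count \<open>Suc depth\<close>.\<close>

lemma general_ladder_layer:
  "general_ladder G (order_by (pverts G) \<theta>) (Suc depth) (\<lambda>j. layer (j - 1)) u"
proof -
  let ?r = "order_by (pverts G) \<theta>" and ?L = "\<lambda>j. layer (j - 1)"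
  have inj: "inj_on ?L {1..Suc depth}"
  proof (rule inj_onI)
    fix i j assume "i \<in> {1..Suc depth}" "j \<in> {1..Suc depth}" "?L i = ?L j"
    moreover from this have "layer (i - 1) \<noteq> {}"
      by (intro layer_nonempty) auto
    ultimately show "i = j"
      by (auto simp: layer_def)
  qed
  have part: "partition_on (pverts G) (?L ` {1..Suc depth})"
  proof (rule partition_onI)
    show "\<Union> (?L ` {1..Suc depth}) = pverts G"
    proof (intro equalityI subsetI)
      fix v assume "v \<in> pverts G"
      then have "v \<in> ?L (Suc (d v))" "Suc (d v) \<in> {1..Suc depth}"
        using in_layer_depth by (auto simp: layer_def)
      then show "v \<in> \<Union> (?L ` {1..Suc depth})"
        by blast
    qed (auto simp: layer_def)
  next
    have "?L j \<noteq> {}" if "j \<in> {1..Suc depth}" for j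
      using that by (intro layer_nonempty) auto
    then show "{} \<notin> ?L ` {1..Suc depth}"
      by blast
  qed (auto simp: disjnt_def layer_def)
  have nbhd: "closed_nbhd G x \<subseteq> ?L (j - 1) \<union> ?L j \<union> ?L (j + 1)" if "x \<in> ?L j" "1 < j" for x j
  proof
    fix y assume "y \<in> closed_nbhd G x"
    then consider "y = x" | "(x, y) \<in> parcs G"
      by (auto simp: closed_nbhd_def)
    then show "y \<in> ?L (j - 1) \<union> ?L j \<union> ?L (j + 1)"
    proof cases
      case 2
      then have "d y \<le> Suc (d x)" "d x \<le> Suc (d y)" "y \<in> pverts G"
        using depth_arc arcs_symmetric in_arcsD2 by blast+
      then show ?thesis
        using that by (auto simp: layer_def)
    qed (use that in simp)
  qed
  have mono: "(rel_max ?r (closed_nbhd G x \<inter> ?L (j + 1)), rel_min ?r (closed_nbhd G y \<inter> ?L (j + 1))) \<in> ?r"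
    if xy: "x \<in> ?L j" "y \<in> ?L j" "1 < j" "rel_less ?r x y"
      and ne: "closed_nbhd G x \<inter> ?L (j + 1) \<noteq> {}" "closed_nbhd G y \<inter> ?L (j + 1) \<noteq> {}" for x y j
  proof -
    have fin: "finite (closed_nbhd G v \<inter> ?L (j + 1))" "closed_nbhd G v \<inter> ?L (j + 1) \<subseteq> pverts G" for v
      using pair_finite_verts by (auto simp: layer_def)
    let ?p = "rel_max ?r (closed_nbhd G x \<inter> ?L (j + 1))"
    let ?q = "rel_min ?r (closed_nbhd G y \<inter> ?L (j + 1))"
    have "?p \<in> closed_nbhd G x \<inter> ?L (j + 1)"
      by (rule rel_max_order_by_in[OF angle_inj fin(1) ne(1) fin(2)])
    moreover have "?q \<in> closed_nbhd G y \<inter> ?L (j + 1)"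
      by (rule rel_min_order_by_in[OF angle_inj fin(1) ne(2) fin(2)])
    moreover have "Suc (d x) = j" "Suc (d y) = j" "\<theta> x < \<theta> y"
      using xy by (auto simp: layer_def rel_less_order_by[OF angle_inj])
    \<comment> \<open>A closed neighbourhood contains its centre, but \<open>x\<close> and
      \<open>y\<close> are one level above \<open>?L (j + 1)\<close>, so only proper neighbours
      remain.\<close>
    ultimately have "(x, ?p) \<in> parcs G" "(y, ?q) \<in> parcs G" "?p \<in> pverts G" "?q \<in> pverts G"
      "d ?p = j" "d ?q = j"
      by (auto simp: closed_nbhd_def layer_def)
    then show ?thesis
      using next_layer_mono[of x ?p y ?q "d x"] \<open>Suc (d x) = j\<close> \<open>Suc (d y) = j\<close> \<open>\<theta> x < \<theta> y\<close>
      by (auto simp: order_by_def)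
  qed
  show ?thesis
    unfolding general_ladder_def
  proof (intro conjI allI ballI impI)
    show "?L 1 = {u}"
      using depth_eq_0 root_in_verts by (auto simp: layer_def)
    show "ordered_subpaths G ?r (?L j)" if "j \<in> {1..Suc depth}" for j
      using that by (intro ordered_subpaths_layer layer_nonempty) auto
    show "linear_order_on (pverts G) ?r"
      by (rule linear_order_order_by[OF angle_inj])
  qed (simp, rule inj, rule part, rule nbhd, assumption+, rule mono, assumption+)
qed

end

section \<open>Graph distance and the circular order\<close>

lemma (in wf_digraph) awalk_cost_one: "awalk_cost (\<lambda>_. 1) p = real (length p)"
  by (induction p) auto

text \<open>Unit costs admit no negative cycle, so the infimum defining the distance is attained by
  a path and is therefore a natural number.\<close>

lemma (in pair_graph) unit_distance:
  assumes conn: "Digraph_Component.connected (with_proj G)" and u: "u \<in> pverts G"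
  obtains d :: "'a \<Rightarrow> nat"
  where "\<And>v. v \<in> pverts G \<Longrightarrow> \<mu> (\<lambda>_. 1) u v = ereal (real (d v))"
    and "\<And>v. v \<in> pverts G \<Longrightarrow> \<exists>p. awalk u p v \<and> length p = d v"
    and "\<And>v p. awalk u p v \<Longrightarrow> d v \<le> length p"
proof -
  have "\<exists>n. (\<exists>p. awalk u p v \<and> length p = n) \<and> \<mu> (\<lambda>_. 1) u v = ereal (real n)"
    if "v \<in> pverts G" for v
  proof -
    have "u \<rightarrow>\<^sup>*\<^bsub>with_proj G\<^esub> v"
      using symmetric_connected_imp_strongly_connected[OF sym_arcs conn] u that
      unfolding strongly_connected_def by simp
    then have "\<exists>p. apath u p v \<and> \<mu> (\<lambda>_. 1) u v = awalk_cost (\<lambda>_. 1) p"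
      by (rule no_neg_cyc_reach_imp_path) (simp add: awalk_cost_one)
    then show ?thesis
      by (auto simp: awalk_cost_one apath_def)
  qed
  then have "\<forall>v\<in>pverts G. \<exists>n. (\<exists>p. awalk u p v \<and> length p = n) \<and> \<mu> (\<lambda>_. 1) u v = ereal (real n)"
    by blast
  from bchoice[OF this] obtain d where d: "\<forall>v\<in>pverts G.
      (\<exists>p. awalk u p v \<and> length p = d v) \<and> \<mu> (\<lambda>_. 1) u v = ereal (real (d v))"
    by (rule exE)
  have "d v \<le> length p" if "awalk u p v" for v p
  proof -
    have "\<mu> (\<lambda>_. 1) u v \<le> ereal (real (length p))"
      using min_cost_le_walk_cost[OF that, of "\<lambda>_. 1"] by (simp add: awalk_cost_one)
    then show ?thesis
      using bspec[OF d awalk_last_in_verts[OF that]] by simp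
  qed
  with d show thesis
    by (intro that[of d]) auto
qed

lemma outer_planar_angles:
  assumes "outer_planar G" "u \<in> pverts G" "pair_graph G"
  obtains \<theta> :: "'a \<Rightarrow> real" where "inj_on \<theta> (pverts G)"
    "\<And>v. v \<in> pverts G \<Longrightarrow> \<theta> u \<le> \<theta> v"
    "\<And>a b c e. (a, b) \<in> parcs G \<Longrightarrow> (c, e) \<in> parcs G \<Longrightarrow>
      \<theta> a < \<theta> c \<Longrightarrow> \<theta> c < \<theta> b \<Longrightarrow> \<theta> b < \<theta> e \<Longrightarrow> False"
proof -
  interpret pair_graph G by fact
  obtain \<phi> :: "'a \<Rightarrow> complex" and z \<rho> where \<rho>: "0 < \<rho>"
    and inj: "inj_on \<phi> (pverts G)" and on: "\<phi> ` pverts G \<subseteq> sphere z \<rho>"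
    and disj: "\<And>a b c e. (a, b) \<in> parcs G \<Longrightarrow> (c, e) \<in> parcs G \<Longrightarrow> {a, b} \<noteq> {c, e} \<Longrightarrow>
        open_segment (\<phi> a) (\<phi> b) \<inter> open_segment (\<phi> c) (\<phi> e) = {}"
    using assms(1) unfolding outer_planar_def by metis
  \<comment> \<open>Dividing by \<open>c\<close> normalises the circle and rotates \<open>u\<close>
    to angle 0, the least value of \<open>Arg2pi\<close>.\<close>
  define c where "c = \<phi> u - z"
  define \<theta> where "\<theta> v = Arg2pi ((\<phi> v - z) / c)" for v
  have nc: "norm c = \<rho>"
    using on assms(2) by (auto simp: c_def dist_norm norm_minus_commute)
  then have c0: "c \<noteq> 0"
    using \<rho> by auto
  have \<phi>: "\<phi> v = z + c * cis (\<theta> v)" if "v \<in> pverts G" for v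
    unfolding \<theta>_def using on that c0 nc by (intro circle_angle) auto
  have bounds: "0 \<le> \<theta> v" "\<theta> v < 2 * pi" for v
    unfolding \<theta>_def using Arg2pi by auto
  show thesis
  proof
    show "inj_on \<theta> (pverts G)"
      using inj \<phi> unfolding inj_on_def by metis
  next
    fix v
    have "\<theta> u = 0"
      using c0 by (simp add: \<theta>_def c_def Arg2pi_eq_0)
    then show "\<theta> u \<le> \<theta> v"
      using bounds by simp
  next
    fix a b p q
    assume arcs: "(a, b) \<in> parcs G" "(p, q) \<in> parcs G"
      and lt: "\<theta> a < \<theta> p" "\<theta> p < \<theta> b" "\<theta> b < \<theta> q"
    have V: "a \<in> pverts G" "b \<in> pverts G" "p \<in> pverts G" "q \<in> pverts G"
      using arcs in_arcsD1 in_arcsD2 by blast+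
    have "\<theta> q < \<theta> a + 2 * pi"
      using bounds(1)[of a] bounds(2)[of q] by linarith
    then have "open_segment (\<phi> a) (\<phi> b) \<inter> open_segment (\<phi> p) (\<phi> q) \<noteq> {}"
      using circle_chords_cross[OF c0 lt] \<phi> V by metis
    moreover have "{a, b} \<noteq> {p, q}"
      using lt by (auto simp: doubleton_eq_iff)
    ultimately show False
      using disj arcs by blast
  qed
qed

theorem lemma5:
  fixes G :: "'a pair_pre_digraph" and u :: 'a
  assumes "pair_graph G"
    and "Digraph_Component.connected (with_proj G)"
    and "outer_planar G"
    and "u \<in> pverts G"
  shows "\<exists>r k. general_ladder G r k (\<lambda>j. dist_layer G u (j - 1)) u"
proof -
  interpret pair_graph G by fact
  show ?thesis
  proof (rule unit_distance[OF assms(2,4)], rule outer_planar_angles[OF assms(3,4,1)])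
    fix d :: "'a \<Rightarrow> nat" and \<theta> :: "'a \<Rightarrow> real"
    assume \<mu>: "\<And>v. v \<in> pverts G \<Longrightarrow> \<mu> (\<lambda>_. 1) u v = ereal (real (d v))"
      and walk: "\<And>v. v \<in> pverts G \<Longrightarrow> \<exists>p. awalk u p v \<and> length p = d v"
      and le: "\<And>v p. awalk u p v \<Longrightarrow> d v \<le> length p"
      and inj: "inj_on \<theta> (pverts G)"
      and root: "\<And>v. v \<in> pverts G \<Longrightarrow> \<theta> u \<le> \<theta> v"
      and cross: "\<And>a b c e. (a, b) \<in> parcs G \<Longrightarrow> (c, e) \<in> parcs G \<Longrightarrow>
        \<theta> a < \<theta> c \<Longrightarrow> \<theta> c < \<theta> b \<Longrightarrow> \<theta> b < \<theta> e \<Longrightarrow> False"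
    have step: "d w \<le> Suc (d v)" if vw: "(v, w) \<in> parcs G" for v w
    proof -
      obtain p where p: "awalk u p v" "length p = d v"
        using walk[OF in_arcsD1[OF vw]] by blast
      then have "awalk u (p @ [(v, w)]) w"
        using vw in_arcsD1 in_arcsD2 by (auto simp: awalk_simps)
      then show ?thesis
        using le[of "p @ [(v, w)]" w] p by simp
    qed
    interpret circular_layering G u \<theta> d
    proof
      show "d v = 0 \<longleftrightarrow> v = u" if "v \<in> pverts G" for v
      proof
        assume "d v = 0"
        then show "v = u"
          using walk[OF that] by (auto simp: awalk_Nil_iff)
      next
        assume "v = u"
        then show "d v = 0"
          using le[of "[]" u] that by (simp add: awalk_Nil_iff)
      qed
    next
      \<comment> \<open>Dropping the last arc of a shortest walk to \<open>v\<close> leaves a walk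
        of length \<open>n\<close>, which bounds the depth of its end from above;
        \<open>step\<close> bounds it from below.\<close>
      fix v n assume v: "v \<in> pverts G" "d v = Suc n"
      then obtain p where p: "awalk u p v" "length p = Suc n"
        using walk by metis
      then obtain q e where q: "p = q @ [e]" "length q = n"
        by (metis length_Suc_conv_rev)
      then have "awalk u q (fst e)" "e \<in> parcs G" "snd e = v"
        using p by (auto simp: awalk_simps)
      then have "(fst e, v) \<in> parcs G" "d (fst e) \<le> n"
        using le[of q "fst e"] q by auto
      then have "d (fst e) = n"
        using step[of "fst e" v] v by simp
      then show "\<exists>w. (w, v) \<in> parcs G \<and> d w = n"
        using \<open>(fst e, v) \<in> parcs G\<close> by blast
    qed (rule assms(4), rule inj, rule root, assumption, rule cross, assumption+, rule step, assumption)
    have "dist_layer G u = layer"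
      using \<mu> by (auto simp: dist_layer_def layer_def fun_eq_iff)
    then show ?thesis
      using general_ladder_layer by auto
  qed
qed

end
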